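(* There exist constants $c>0$ and $\epsilon_0>0$ such that for every $\epsilon\in(0,\epsilon_0)$ there is an instance of the online weighted \textsc{MaximumIndependentSet} problem, whose graph contains only three vertices forming a path, on which every online algorithm that maintains at every time an independent set of weight at least $(1-\epsilon)\,\mathrm{opt}$ has amortized migration factor at least $c/\epsilon$.
   Context: Online weighted \textsc{MaximumIndependentSet} (dynamic): starting from the empty graph, at each time step one weighted vertex arrives together with its edges to present vertices, or one present vertex departs together with its edges. The algorithm outputs an independent set $S_t$ of the current graph at each time without knowledge of the future, and $\mathrm{opt}$ is the current maximum weight of an independent set. The migration potential of a step is the weight of the arriving or departing vertex. The migration cost of changing $S_{t-1}$ to $S_t$ is the total weight of $S_{t-1}\triangle S_t$, excluding the initial inclusion of a newly arrived vertex. The amortized migration factor is the maximum over $t$ of (total migration cost up to $t$)/(total migration potential up to $t$). *)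

theory Defs
  imports Complex_Main
begin

record 'v wgraph =
  verts :: "'v set"
  edges :: "'v set set"
  weight :: "'v \<Rightarrow> real"

text \<open>In \<open>Arrive v x N\<close> the vertex \<open>v\<close> has weight \<open>x\<close>, and \<open>N\<close> is its set of neighbours among
  the vertices present. A vertex that has departed may arrive again.\<close>

datatype 'v event = Arrive 'v real "'v set" | Depart 'v

definition empty_graph :: "'v wgraph" where
  "empty_graph = \<lparr>verts = {}, edges = {}, weight = (\<lambda>_. 0)\<rparr>"

text \<open>The weight function is meaningful on the present vertices; a departing vertex keeps its value,
  so that the migration cost of its departure can be read off the new graph.\<close>

fun update :: "'v wgraph \<Rightarrow> 'v event \<Rightarrow> 'v wgraph" where
  "update G (Arrive v x N) =
     \<lparr>verts = insert v (verts G), edges = edges G \<union> {{u, v} | u. u \<in> N}, weight = (weight G)(v := x)\<rparr>"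
| "update G (Depart v) =
     \<lparr>verts = verts G - {v}, edges = {e \<in> edges G. v \<notin> e}, weight = weight G\<rparr>"

fun admissible :: "'v wgraph \<Rightarrow> 'v event \<Rightarrow> bool" where
  "admissible G (Arrive v x N) \<longleftrightarrow> v \<notin> verts G \<and> 0 < x \<and> N \<subseteq> verts G"
| "admissible G (Depart v) \<longleftrightarrow> v \<in> verts G"

definition graph_at :: "'v event list \<Rightarrow> nat \<Rightarrow> 'v wgraph" where
  "graph_at \<sigma> t = foldl update empty_graph (take t \<sigma>)"

definition valid_instance :: "'v event list \<Rightarrow> bool" where
  "valid_instance \<sigma> \<longleftrightarrow> (\<forall>t < length \<sigma>. admissible (graph_at \<sigma> t) (\<sigma> ! t))"

definition weighted_induced_subgraph :: "'v wgraph \<Rightarrow> 'v wgraph \<Rightarrow> bool" where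
  "weighted_induced_subgraph G H \<longleftrightarrow>
     verts G \<subseteq> verts H \<and> edges G = {e \<in> edges H. e \<subseteq> verts G} \<and>
     (\<forall>v \<in> verts G. weight G v = weight H v)"

text \<open>\<open>H\<close> is the weighted graph on which the instance \<open>\<sigma>\<close> takes place: vertices of \<open>H\<close> come and go,
  always with the same weights and adjacencies, and all of \<open>H\<close> is present at some time.\<close>

definition instance_on :: "'v wgraph \<Rightarrow> 'v event list \<Rightarrow> bool" where
  "instance_on H \<sigma> \<longleftrightarrow>
     (\<forall>t \<le> length \<sigma>. weighted_induced_subgraph (graph_at \<sigma> t) H) \<and>
     (\<exists>t \<le> length \<sigma>. verts (graph_at \<sigma> t) = verts H)"

definition three_vertex_path :: "'v wgraph \<Rightarrow> bool" where
  "three_vertex_path H \<longleftrightarrow>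
     (\<exists>a b c. distinct [a, b, c] \<and> verts H = {a, b, c} \<and> edges H = {{a, b}, {b, c}})"

definition independent_set :: "'v wgraph \<Rightarrow> 'v set \<Rightarrow> bool" where
  "independent_set G S \<longleftrightarrow> S \<subseteq> verts G \<and> (\<forall>u \<in> S. \<forall>v \<in> S. {u, v} \<notin> edges G)"

definition set_weight :: "'v wgraph \<Rightarrow> 'v set \<Rightarrow> real" where
  "set_weight G S = (\<Sum>v\<in>S. weight G v)"

definition opt_weight :: "'v wgraph \<Rightarrow> real" where
  "opt_weight G = Max (set_weight G ` {S. independent_set G S})"

text \<open>A (deterministic) online algorithm maps the history, i.e.\ the list of events seen so far,
  to the current solution.\<close>

type_synonym 'v online_alg = "'v event list \<Rightarrow> 'v set"

definition solution_at :: "'v online_alg \<Rightarrow> 'v event list \<Rightarrow> nat \<Rightarrow> 'v set" where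
  "solution_at A \<sigma> t = A (take t \<sigma>)"

definition maintains_approx :: "real \<Rightarrow> 'v online_alg \<Rightarrow> 'v event list \<Rightarrow> bool" where
  "maintains_approx \<epsilon> A \<sigma> \<longleftrightarrow>
     (\<forall>t \<le> length \<sigma>.
        independent_set (graph_at \<sigma> t) (solution_at A \<sigma> t) \<and>
        set_weight (graph_at \<sigma> t) (solution_at A \<sigma> t) \<ge> (1 - \<epsilon>) * opt_weight (graph_at \<sigma> t))"

fun event_weight :: "'v wgraph \<Rightarrow> 'v event \<Rightarrow> real" where
  "event_weight G (Arrive v x N) = x"
| "event_weight G (Depart v) = weight G v"

fun newly_arrived :: "'v event \<Rightarrow> 'v set" where
  "newly_arrived (Arrive v x N) = {v}"
| "newly_arrived (Depart v) = {}"

text \<open>Steps are indexed from 0: step \<open>i\<close> is the event \<open>\<sigma> ! i\<close>, which leads from time \<open>i\<close> to time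
  \<open>Suc i\<close>. The arriving vertex of a step is not in the previous solution, so removing it from the
  symmetric difference excludes exactly its initial inclusion.\<close>

definition migration_potential :: "'v event list \<Rightarrow> nat \<Rightarrow> real" where
  "migration_potential \<sigma> i = event_weight (graph_at \<sigma> i) (\<sigma> ! i)"

definition migration_cost :: "'v online_alg \<Rightarrow> 'v event list \<Rightarrow> nat \<Rightarrow> real" where
  "migration_cost A \<sigma> i =
     set_weight (graph_at \<sigma> (Suc i))
       (sym_diff (solution_at A \<sigma> i) (solution_at A \<sigma> (Suc i)) - newly_arrived (\<sigma> ! i))"

definition amortized_migration_factor :: "'v online_alg \<Rightarrow> 'v event list \<Rightarrow> real" where
  "amortized_migration_factor A \<sigma> =
     Max ((\<lambda>t. (\<Sum>i<t. migration_cost A \<sigma> i) / (\<Sum>i<t. migration_potential \<sigma> i)) ` {1..length \<sigma>})"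

end

theory Submission
  imports Defs
begin

text \<open>On the path with vertices 0, 1, 2 of weights \<open>1 - 2\<epsilon>\<close>, \<open>1\<close>, \<open>4\<epsilon>\<close>, the vertex 2 arrives and
  departs over and over again. While it is absent, the only sufficiently heavy independent set is
  \<open>{1}\<close>; while it is present, it is \<open>{0, 2}\<close>, of weight \<open>1 + 2\<epsilon>\<close>. So each step of potential \<open>4\<epsilon>\<close>
  forces a migration of cost at least \<open>2 - 2\<epsilon>\<close>, and with \<open>1 / (4\<epsilon>)\<close> repetitions the
  potential of the first two arrivals is amortized.\<close>

definition toggle_event :: "real \<Rightarrow> nat \<Rightarrow> nat event" where
  "toggle_event \<epsilon> t =
     (if t = 0 then Arrive 0 (1 - 2 * \<epsilon>) {} else if t = 1 then Arrive 1 1 {0}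
      else if even t then Arrive 2 (4 * \<epsilon>) {1} else Depart 2)"

definition toggle_instance :: "real \<Rightarrow> nat \<Rightarrow> nat event list" where
  "toggle_instance \<epsilon> n = map (toggle_event \<epsilon>) [0..<n]"

text \<open>Closed form of the graph after \<open>t\<close> events. The weight of vertex 2 stays at
  \<open>4 * \<epsilon>\<close> for every \<open>t\<close> from 3 on, present or not, because
  \<open>update\<close> keeps the weight of a departed vertex.\<close>

definition toggle_graph :: "real \<Rightarrow> nat \<Rightarrow> nat wgraph" where
  "toggle_graph \<epsilon> t =
     \<lparr>verts = (if t = 0 then {} else if t = 1 then {0} else if even t then {0, 1} else {0, 1, 2}),
      edges = (if t \<le> 1 then {} else if even t then {{0, 1}} else {{0, 1}, {1, 2}}),
      weight = (\<lambda>v. if v = 0 \<and> 1 \<le> t then 1 - 2 * \<epsilon> else if v = 1 \<and> 2 \<le> t then 1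
                    else if v = 2 \<and> 3 \<le> t then 4 * \<epsilon> else 0)\<rparr>"

lemma length_toggle_instance [simp]: "length (toggle_instance \<epsilon> n) = n"
  by (simp add: toggle_instance_def)

lemma nth_toggle_instance [simp]: "t < n \<Longrightarrow> toggle_instance \<epsilon> n ! t = toggle_event \<epsilon> t"
  by (simp add: toggle_instance_def)

text \<open>One case for each shape that \<open>toggle_graph\<close> takes.\<close>

lemma toggle_cases [case_names zero one even odd]:
  fixes t :: nat
  obtains "t = 0" | "t = 1" | "even t" "2 \<le> t" | "odd t" "3 \<le> t"
proof -
  have "t = 0 \<or> t = 1 \<or> even t \<and> 2 \<le> t \<or> odd t \<and> 3 \<le> t"
    by presburger
  with that show ?thesis
    by blast
qed

lemma update_toggle_graph: "update (toggle_graph \<epsilon> t) (toggle_event \<epsilon> t) = toggle_graph \<epsilon> (Suc t)"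
  by (cases t rule: toggle_cases) (auto simp: toggle_graph_def toggle_event_def fun_eq_iff)

lemma graph_at_toggle_instance:
  "t \<le> n \<Longrightarrow> graph_at (toggle_instance \<epsilon> n) t = toggle_graph \<epsilon> t"
proof (induction t)
  case 0
  show ?case by (simp add: graph_at_def toggle_graph_def empty_graph_def)
next
  case (Suc t)
  then have "graph_at (toggle_instance \<epsilon> n) (Suc t)
      = update (graph_at (toggle_instance \<epsilon> n) t) (toggle_event \<epsilon> t)"
    by (simp add: graph_at_def take_Suc_conv_app_nth)
  with Suc show ?case by (simp add: update_toggle_graph)
qed

lemma valid_toggle_instance:
  assumes "0 < \<epsilon>" "\<epsilon> < 1/2"
  shows "valid_instance (toggle_instance \<epsilon> n)"
  using assms
  by (auto simp: valid_instance_def graph_at_toggle_instance toggle_event_def toggle_graph_def)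

lemma three_vertex_path_toggle_graph: "three_vertex_path (toggle_graph \<epsilon> 3)"
  unfolding three_vertex_path_def
  by (intro exI[of _ 0] exI[of _ 1] exI[of _ 2]) (simp add: toggle_graph_def)

lemma instance_on_toggle_instance:
  assumes "3 \<le> n"
  shows "instance_on (toggle_graph \<epsilon> 3) (toggle_instance \<epsilon> n)"
proof -
  \<comment> \<open>Evaluates the induced edge set in the form it takes once the definitions are
    unfolded.\<close>
  have edges: "{e. (e = {0, 1} \<or> e = {1, 2}) \<and> e \<subseteq> V} =
      (if {0, 1} \<subseteq> V then {{0, 1}} else {}) \<union> (if {1, 2} \<subseteq> V then {{1, 2}} else {})"
    for V :: "nat set"
    by auto
  have "weighted_induced_subgraph (toggle_graph \<epsilon> t) (toggle_graph \<epsilon> 3)" for t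
    using edges
    by (cases t rule: toggle_cases) (simp_all add: weighted_induced_subgraph_def toggle_graph_def insert_commute)
  with assms show ?thesis
    by (auto simp: instance_on_def graph_at_toggle_instance intro!: exI[of _ 3])
qed

lemma set_weight_le_opt_weight:
  assumes "finite (verts G)" "independent_set G S"
  shows "set_weight G S \<le> opt_weight G"
proof -
  have "{S. independent_set G S} \<subseteq> Pow (verts G)"
    by (auto simp: independent_set_def)
  then have "finite {S. independent_set G S}"
    using assms(1) finite_subset by blast
  with assms(2) show ?thesis
    by (auto simp: opt_weight_def)
qed

text \<open>The set \<open>{1}\<close> shows that the optimum is at least 1, while the rivals
  \<open>{}\<close> and \<open>{0}\<close> weigh at most \<open>1 - 2 * \<epsilon>\<close>, which is
  below \<open>1 - \<epsilon>\<close>.\<close>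

lemma approx_without_vertex_2:
  assumes "0 < \<epsilon>" "even t" "2 \<le> t"
    and S: "independent_set (toggle_graph \<epsilon> t) S"
    and approx: "(1 - \<epsilon>) * opt_weight (toggle_graph \<epsilon> t) \<le> set_weight (toggle_graph \<epsilon> t) S"
    and "\<epsilon> < 1/2"
  shows "S = {1}"
proof -
  have "set_weight (toggle_graph \<epsilon> t) {1} \<le> opt_weight (toggle_graph \<epsilon> t)"
    using assms by (intro set_weight_le_opt_weight) (auto simp: toggle_graph_def independent_set_def)
  moreover have "set_weight (toggle_graph \<epsilon> t) {1} = 1"
    using assms by (simp add: toggle_graph_def set_weight_def)
  ultimately have "(1 - \<epsilon>) * 1 \<le> (1 - \<epsilon>) * opt_weight (toggle_graph \<epsilon> t)"
    using assms by (intro mult_left_mono) auto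
  with approx have heavy: "1 - \<epsilon> \<le> set_weight (toggle_graph \<epsilon> t) S"
    by simp
  have "S \<in> Pow {0, 1}" "\<not> (0 \<in> S \<and> 1 \<in> S)"
    using S assms by (auto simp: independent_set_def toggle_graph_def split: if_splits)
  then have "S = {} \<or> S = {0} \<or> S = {1}"
    by (auto simp: Pow_insert)
  with heavy assms show ?thesis
    by (auto simp: set_weight_def toggle_graph_def)
qed

text \<open>Here \<open>{0, 2}\<close> raises the optimum to at least
  \<open>1 + 2 * \<epsilon>\<close>, so that a solution must weigh more than 1. This excludes
  \<open>{1}\<close> and, since \<open>4 * \<epsilon> < 1\<close>, also \<open>{2}\<close>.\<close>

lemma approx_with_vertex_2:
  assumes "0 < \<epsilon>" "odd t" "3 \<le> t"
    and S: "independent_set (toggle_graph \<epsilon> t) S"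
    and approx: "(1 - \<epsilon>) * opt_weight (toggle_graph \<epsilon> t) \<le> set_weight (toggle_graph \<epsilon> t) S"
    and "\<epsilon> < 1/4"
  shows "S = {0, 2}"
proof -
  have "set_weight (toggle_graph \<epsilon> t) {0, 2} \<le> opt_weight (toggle_graph \<epsilon> t)"
    using assms by (intro set_weight_le_opt_weight)
      (auto simp: toggle_graph_def independent_set_def doubleton_eq_iff)
  moreover have "set_weight (toggle_graph \<epsilon> t) {0, 2} = 1 + 2 * \<epsilon>"
    using assms by (simp add: toggle_graph_def set_weight_def)
  ultimately have "(1 - \<epsilon>) * (1 + 2 * \<epsilon>) \<le> (1 - \<epsilon>) * opt_weight (toggle_graph \<epsilon> t)"
    using assms by (intro mult_left_mono) auto
  moreover have "1 < (1 - \<epsilon>) * (1 + 2 * \<epsilon>)"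
    \<comment> \<open>The product exceeds 1 by
      \<open>\<epsilon> - 2 * \<epsilon> * \<epsilon>\<close>, which is positive as
      \<open>\<epsilon> < 1/2\<close>.\<close>
    using mult_strict_left_mono[of \<epsilon> "1/2" \<epsilon>] assms by (simp add: algebra_simps)
  ultimately have heavy: "1 < set_weight (toggle_graph \<epsilon> t) S"
    using approx by simp
  have "S \<in> Pow {0, 1, 2}" "\<not> (0 \<in> S \<and> 1 \<in> S)" "\<not> (1 \<in> S \<and> 2 \<in> S)"
    using S assms by (auto simp: independent_set_def toggle_graph_def split: if_splits)
  then have "S = {} \<or> S = {0} \<or> S = {1} \<or> S = {2} \<or> S = {0, 2}"
    by (auto simp: Pow_insert)
  with heavy assms show ?thesis
    by (auto simp: set_weight_def toggle_graph_def)
qed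

lemma set_weight_toggle_graph_nonneg:
  assumes "0 < \<epsilon>" "\<epsilon> < 1/2"
  shows "0 \<le> set_weight (toggle_graph \<epsilon> t) S"
  using assms by (auto simp: set_weight_def toggle_graph_def intro: sum_nonneg)

text \<open>The solution is forced before and after the step, and vertices 0 and 1 swap roles at a
  cost of \<open>2 - 2 * \<epsilon>\<close>. An arrival of vertex 2 adds nothing, its inclusion
  being free; a departure adds its retained weight \<open>4 * \<epsilon>\<close>.\<close>

lemma migration_cost_toggle_instance:
  assumes "0 < \<epsilon>" "\<epsilon> < 1/4" "2 \<le> t" "t < n"
    and "maintains_approx \<epsilon> A (toggle_instance \<epsilon> n)"
  shows "2 - 2 * \<epsilon> \<le> migration_cost A (toggle_instance \<epsilon> n) t"
proof -
  let ?S = "solution_at A (toggle_instance \<epsilon> n)"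
  have approx: "independent_set (toggle_graph \<epsilon> s) (?S s)"
      "(1 - \<epsilon>) * opt_weight (toggle_graph \<epsilon> s) \<le> set_weight (toggle_graph \<epsilon> s) (?S s)"
    if "s \<le> n" for s
    using assms(5) that by (auto simp: maintains_approx_def graph_at_toggle_instance)
  have absent: "?S s = {1}" if "even s" "2 \<le> s" "s \<le> n" for s
    using assms that approx by (intro approx_without_vertex_2[of \<epsilon> s]) auto
  have present: "?S s = {0, 2}" if "odd s" "3 \<le> s" "s \<le> n" for s
    using assms that approx by (intro approx_with_vertex_2[of \<epsilon> s]) auto
  show ?thesis
  proof (cases "even t")
    case True
    then have "?S t = {1}" "?S (Suc t) = {0, 2}"
      using absent[of t] present[of "Suc t"] assms by auto
    moreover from this have "sym_diff (?S t) (?S (Suc t)) - newly_arrived (toggle_event \<epsilon> t) = {0, 1}"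
      using True assms by (auto simp: toggle_event_def)
    ultimately show ?thesis
      using True assms
      by (simp add: migration_cost_def graph_at_toggle_instance set_weight_def toggle_graph_def)
  next
    case False
    with assms have "3 \<le> t"
      by (cases "t = 2") auto
    then have "?S t = {0, 2}" "?S (Suc t) = {1}"
      using absent[of "Suc t"] present[of t] assms False by auto
    moreover from this
    have "sym_diff (?S t) (?S (Suc t)) - newly_arrived (toggle_event \<epsilon> t) = {0, 1, 2}"
      using False assms by (auto simp: toggle_event_def)
    ultimately show ?thesis
      using False assms
      by (simp add: migration_cost_def graph_at_toggle_instance set_weight_def toggle_graph_def)
  qed
qed

lemma migration_potential_toggle_instance:
  assumes "t < n"
  shows "migration_potential (toggle_instance \<epsilon> n) t =
    (if t = 0 then 1 - 2 * \<epsilon> else if t = 1 then 1 else 4 * \<epsilon>)"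
proof -
  \<comment> \<open>At a departure this selects the weight \<open>4 * \<epsilon>\<close> of vertex 2
    instead of the default 0.\<close>
  have "3 \<le> t" if "odd t" "t \<noteq> 1"
    using that by presburger
  with assms show ?thesis
    by (auto simp: migration_potential_def graph_at_toggle_instance toggle_event_def toggle_graph_def)
qed

lemma sum_lessThan_add_2:
  fixes f :: "nat \<Rightarrow> 'a::comm_monoid_add"
  shows "(\<Sum>i<m + 2. f i) = f 0 + (f 1 + (\<Sum>i<m. f (i + 2)))"
  by (simp add: sum.lessThan_Suc_shift del: sum.lessThan_Suc)

text \<open>The ratio at the final time already suffices: by the choice of \<open>m\<close>, the
  total potential is at most \<open>2 + 4 * \<epsilon> * m \<le> 8 * \<epsilon> * m\<close>, and the
  total cost is at least \<open>m\<close>.\<close>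

lemma amortized_migration_factor_toggle_instance:
  assumes "0 < \<epsilon>" "\<epsilon> < 1/4" and m: "1 \<le> 2 * \<epsilon> * real m"
    and A: "maintains_approx \<epsilon> A (toggle_instance \<epsilon> (m + 2))"
  shows "1 / 8 / \<epsilon> \<le> amortized_migration_factor A (toggle_instance \<epsilon> (m + 2))"
proof -
  define \<sigma> where "\<sigma> = toggle_instance \<epsilon> (m + 2)"
  let ?C = "\<Sum>i<m + 2. migration_cost A \<sigma> i" and ?P = "\<Sum>i<m + 2. migration_potential \<sigma> i"
  have nonneg: "0 \<le> migration_cost A \<sigma> i" if "i < m + 2" for i
    using that assms set_weight_toggle_graph_nonneg[of \<epsilon>]
    by (simp add: \<sigma>_def migration_cost_def graph_at_toggle_instance)
  have "real m * (2 - 2 * \<epsilon>) = (\<Sum>i<m. 2 - 2 * \<epsilon>)"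
    by simp
  also have "\<dots> \<le> (\<Sum>i<m. migration_cost A \<sigma> (i + 2))"
    unfolding \<sigma>_def using assms by (intro sum_mono migration_cost_toggle_instance) auto
  \<comment> \<open>The costs of the first two steps are only known to be nonnegative and are
    dropped.\<close>
  also have "\<dots> \<le> ?C"
    using nonneg[of 0] nonneg[of 1] unfolding sum_lessThan_add_2 by simp
  finally have C: "real m * (2 - 2 * \<epsilon>) \<le> ?C" .
  have P: "?P = 2 - 2 * \<epsilon> + real m * (4 * \<epsilon>)"
    unfolding sum_lessThan_add_2 by (simp add: \<sigma>_def migration_potential_toggle_instance)
  \<comment> \<open>Bounds the nonlinear term of \<open>real m * (2 - 2 * \<epsilon>)\<close>, which
    is then at least \<open>real m\<close>.\<close>
  have "real m * \<epsilon> \<le> real m * (1/4)"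
    using assms by (intro mult_left_mono) auto
  then have "?P \<le> 8 * \<epsilon> * real m" "real m \<le> ?C" "0 < ?P"
    using C P m assms by (simp_all add: algebra_simps add_nonneg_pos)
  then have "?P \<le> 8 * \<epsilon> * ?C"
    using assms by (smt (verit) mult_left_mono)
  with \<open>0 < ?P\<close> have "1 / 8 / \<epsilon> \<le> ?C / ?P"
    using assms by (simp add: field_simps)
  also have "\<dots> \<le> amortized_migration_factor A \<sigma>"
    unfolding amortized_migration_factor_def by (intro Max_ge imageI) (auto simp: \<sigma>_def)
  finally show ?thesis
    by (simp add: \<sigma>_def)
qed

theorem theorem21:
  shows "\<exists>c>0. \<exists>\<epsilon>\<^sub>0>0. \<forall>\<epsilon>::real. 0 < \<epsilon> \<and> \<epsilon> < \<epsilon>\<^sub>0 \<longrightarrow>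
    (\<exists>(\<sigma> :: nat event list) H.
       valid_instance \<sigma> \<and> instance_on H \<sigma> \<and> three_vertex_path H \<and>
       (\<forall>A :: nat online_alg. maintains_approx \<epsilon> A \<sigma> \<longrightarrow>
          amortized_migration_factor A \<sigma> \<ge> c / \<epsilon>))"
proof -
  have "\<exists>(\<sigma> :: nat event list) H.
       valid_instance \<sigma> \<and> instance_on H \<sigma> \<and> three_vertex_path H \<and>
       (\<forall>A :: nat online_alg. maintains_approx \<epsilon> A \<sigma> \<longrightarrow>
          amortized_migration_factor A \<sigma> \<ge> 1 / 8 / \<epsilon>)"
    if \<epsilon>: "0 < \<epsilon> \<and> \<epsilon> < 1/4" for \<epsilon> :: real
  proof -
    \<comment> \<open>With this \<open>m\<close>, the toggling steps have total potential
      \<open>4 * \<epsilon> * m \<ge> 2\<close>, more than the first two arrivals together.\<close>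
    obtain m :: nat where "1 / (2 * \<epsilon>) \<le> real m"
      using real_arch_simple by blast
    with \<epsilon> have m: "1 \<le> 2 * \<epsilon> * real m"
      by (simp add: field_simps)
    \<comment> \<open>Vertex 2 thus arrives at least once, so the whole path is present at time
      3.\<close>
    then have "1 \<le> m"
      by (cases m) auto
    let ?\<sigma> = "toggle_instance \<epsilon> (m + 2)"
    have "valid_instance ?\<sigma>"
      using \<epsilon> by (intro valid_toggle_instance) auto
    moreover have "instance_on (toggle_graph \<epsilon> 3) ?\<sigma>"
      using \<open>1 \<le> m\<close> by (intro instance_on_toggle_instance) auto
    moreover have "\<forall>A. maintains_approx \<epsilon> A ?\<sigma> \<longrightarrow> 1 / 8 / \<epsilon> \<le> amortized_migration_factor A ?\<sigma>"
      using \<epsilon> m amortized_migration_factor_toggle_instance by blast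
    ultimately show ?thesis
      using three_vertex_path_toggle_graph by blast
  qed
  then show ?thesis
    by (intro exI[of _ "1/8"] conjI exI[of _ "1/4"] allI impI) auto
qed

end
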